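(* Suppose that: (i) $c(x,x')=(x-x')^TA(x)(x-x')$ is lower semicontinuous and there are positive constants $\rho_{\min},\rho_{\max}$ with $\rho_{\min}\le v^TA(x)v\le\rho_{\max}$ for all unit vectors $v$ and $P_0$-almost every $x\in\mathbb{R}^d$; (ii) $\ell:\mathbb{R}\to\mathbb{R}$ is convex, $\kappa:=\inf\{s\ge0:\sup_{u\in\mathbb{R}}(\ell(u)-su^2)<\infty\}$ is finite, and $E_{P_0}\|X\|^4<\infty$; (iii) $\ell$ is twice differentiable with $\ell''(\cdot)\le M$ for a positive constant $M$, and $P_0$ is such that $\ell'(\beta^TX)$ is not identically $0$, for any $\beta\in B$; (iv) $B\subseteq\mathbb{R}^d$ is convex and compact, with $R_\beta:=\sup_{\beta\in B}\|\beta\|<\infty$. Then for any $\beta\in B$ and any dual optimizer $\lambda_*(\beta)\in\arg\min_{\lambda\ge0}f_\delta(\beta,\lambda)$, we have $(\beta,\lambda_*(\beta))\in\mathbb{V}$, where $$\mathbb{V}:=\{(\beta,\lambda)\in B\times\mathbb{R}_+:\ K_1\|\beta\|\le\lambda\le K_2\|\beta\|\},$$ for some positive constants $K_1,K_2$ which can be explicitly determined in terms of the parameters $\delta,M,R_\beta,\rho_{\max},\rho_{\min}$.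
   Context: Let $d\ge1$, $B\subseteq\mathbb{R}^d$, $\delta>0$, $P_0$ a Borel probability measure on $\mathbb{R}^d$, $\ell:\mathbb{R}\to\mathbb{R}$, and $A:\mathbb{R}^d\to\mathbb{S}_d^{++}$ (real symmetric positive definite $d\times d$ matrices). $E_{P_0}$ denotes expectation with $X\sim P_0$, $\mathbb{R}_+=[0,\infty)$, and $\|\cdot\|$ is the Euclidean norm. Define $$F(\gamma,\beta,\lambda;x)=\ell\big(\beta^Tx+\gamma\sqrt\delta\,\beta^TA(x)^{-1}\beta\big)-\lambda\sqrt\delta\,\big(\gamma^2\beta^TA(x)^{-1}\beta-1\big),$$ $\ell_{rob}(\beta,\lambda;x)=\sup_{\gamma\in\mathbb{R}}F(\gamma,\beta,\lambda;x)$ and $f_\delta(\beta,\lambda)=E_{P_0}[\ell_{rob}(\beta,\lambda;X)]$. The set $\arg\min_{\lambda\ge0}f_\delta(\beta,\lambda)$ is nonempty for every $\beta\in B$.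
   Formalization: For fixed d, K1 and K2 depend on δ, M, R_β, ρ_max, ρ_min and also on the inf and sup over β in B of the L²(P_0)-norm of ℓ'(β^T X); the five alone do not suffice: for ℓ(u)=εu, A=I, δ=1 the optimizer is ε‖β‖/2. *)

theory Defs
  imports "HOL-Probability.Probability"
begin

definition sym_pos_def :: "real^'n^'n \<Rightarrow> bool" where
  "sym_pos_def Q \<longleftrightarrow> transpose Q = Q \<and> (\<forall>v. v \<noteq> 0 \<longrightarrow> v \<bullet> (Q *v v) > 0)"

definition lower_semicontinuous :: "('a::topological_space \<Rightarrow> real) \<Rightarrow> bool" where
  "lower_semicontinuous f \<longleftrightarrow> (\<forall>x. \<forall>y < f x. eventually (\<lambda>z. y < f z) (nhds x))"

definition cost :: "(real^'n \<Rightarrow> real^'n^'n) \<Rightarrow> real^'n \<Rightarrow> real^'n \<Rightarrow> real" where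
  "cost A x x' = (x - x') \<bullet> (A x *v (x - x'))"

text \<open>An ereal infimum, so that the infimum of the empty set is infinite.\<close>

definition kappa :: "(real \<Rightarrow> real) \<Rightarrow> ereal" where
  "kappa l = Inf {ereal s | s. s \<ge> 0 \<and> (SUP u. ereal (l u - s * u\<^sup>2)) < \<infinity>}"

definition inv_form :: "(real^'n \<Rightarrow> real^'n^'n) \<Rightarrow> real^'n \<Rightarrow> real^'n \<Rightarrow> real" where
  "inv_form A \<beta> x = \<beta> \<bullet> (matrix_inv (A x) *v \<beta>)"

definition F_obj ::
  "real \<Rightarrow> (real \<Rightarrow> real) \<Rightarrow> (real^'n \<Rightarrow> real^'n^'n)
    \<Rightarrow> real \<Rightarrow> real^'n \<Rightarrow> real \<Rightarrow> real^'n \<Rightarrow> real" where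
  "F_obj \<delta> l A \<gamma> \<beta> lam x =
     l (\<beta> \<bullet> x + \<gamma> * sqrt \<delta> * inv_form A \<beta> x) - lam * sqrt \<delta> * (\<gamma>\<^sup>2 * inv_form A \<beta> x - 1)"

definition l_rob ::
  "real \<Rightarrow> (real \<Rightarrow> real) \<Rightarrow> (real^'n \<Rightarrow> real^'n^'n)
    \<Rightarrow> real^'n \<Rightarrow> real \<Rightarrow> real^'n \<Rightarrow> ereal" where
  "l_rob \<delta> l A \<beta> lam x = (SUP \<gamma>. ereal (F_obj \<delta> l A \<gamma> \<beta> lam x))"

text \<open>
  The expectation of an extended-real random variable, as the integral of the positive part minus
  the integral of the negative part (\<^const>\<open>e2ennreal\<close> truncates negative arguments to 0).
  The value is meaningful if at most one of the two integrals is infinite.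
\<close>

definition ereal_expectation :: "'a measure \<Rightarrow> ('a \<Rightarrow> ereal) \<Rightarrow> ereal" where
  "ereal_expectation P f =
     enn2ereal (\<integral>\<^sup>+ x. e2ennreal (f x) \<partial>P) - enn2ereal (\<integral>\<^sup>+ x. e2ennreal (- f x) \<partial>P)"

definition f_dual ::
  "(real^'n) measure \<Rightarrow> real \<Rightarrow> (real \<Rightarrow> real) \<Rightarrow> (real^'n \<Rightarrow> real^'n^'n)
    \<Rightarrow> real^'n \<Rightarrow> real \<Rightarrow> ereal" where
  "f_dual P0 \<delta> l A \<beta> lam = ereal_expectation P0 (l_rob \<delta> l A \<beta> lam)"

definition V_region :: "(real^'n) set \<Rightarrow> real \<Rightarrow> real \<Rightarrow> ((real^'n) \<times> real) set" where
  "V_region B K1 K2 =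
     {(\<beta>, lam). \<beta> \<in> B \<and> 0 \<le> lam \<and> K1 * norm \<beta> \<le> lam \<and> lam \<le> K2 * norm \<beta>}"

text \<open>
  The constants bounding the dual optimizers cannot depend on the curvature bound, the radii and the
  eigenvalue bounds alone: if the loss is linear with slope \<open>\<epsilon> > 0\<close> and \<open>A x\<close> is the identity, the
  dual optimizer is \<open>\<epsilon> * norm \<beta> / 2\<close>, whatever the other parameters.  The size of
  the derivative of the loss enters through the following two numbers, the smallest and the largest
  \<open>L\<^sup>2\<close>-norm of \<open>l' (\<beta> \<bullet> X)\<close> as \<open>\<beta>\<close> ranges over \<open>B\<close>.
\<close>

definition slope_norm :: "(real^'n) measure \<Rightarrow> (real \<Rightarrow> real) \<Rightarrow> real^'n \<Rightarrow> real" where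
  "slope_norm P0 l \<beta> = sqrt (\<integral>x. (deriv l (\<beta> \<bullet> x))\<^sup>2 \<partial>P0)"

definition slope_min :: "(real^'n) measure \<Rightarrow> (real \<Rightarrow> real) \<Rightarrow> (real^'n) set \<Rightarrow> real" where
  "slope_min P0 l B = (INF \<beta>\<in>B. slope_norm P0 l \<beta>)"

definition slope_max :: "(real^'n) measure \<Rightarrow> (real \<Rightarrow> real) \<Rightarrow> (real^'n) set \<Rightarrow> real" where
  "slope_max P0 l B = (SUP \<beta>\<in>B. slope_norm P0 l \<beta>)"

end

theory Submission
  imports Defs
begin

text \<open>
  The dual optimizer is compared with the trial value
  \<open>M * sqrt \<delta> * (norm \<beta>)\<^sup>2 / (2 * \<rho>min) + norm \<beta>\<close>.  Its dual objective is bounded above by the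
  quadratic upper bound \<open>l (u + t) \<le> l u + deriv l u * t + M * t\<^sup>2 / 2\<close>, which turns the supremum over
  \<open>\<gamma>\<close> into that of a concave parabola.  The tangent bound \<open>l u + deriv l u * t \<le> l (u + t)\<close> gives,
  for every multiplier \<open>lam\<close>, a lower bound of the dual objective that exceeds the expected loss by
  \<open>sqrt \<delta>\<close> times \<open>lam\<close> plus a term of order \<open>(norm \<beta>)\<^sup>2 / lam\<close>.  So neither of these two summands can
  exceed the bound of order \<open>norm \<beta>\<close> that the trial value provides.
\<close>

section \<open>Convex losses with bounded curvature\<close>

lemma convex_deriv_lower:
  fixes l :: "real \<Rightarrow> real"
  assumes "convex_on UNIV l" "\<And>u. l differentiable (at u)"
  shows "l u + deriv l u * (v - u) \<le> l v"
proof -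
  have "(l has_real_derivative deriv l u) (at u)"
    using assms(2) by (simp add: DERIV_deriv_iff_real_differentiable)
  then have "l v - l u \<ge> deriv l u * (v - u)"
    by (intro convex_on_imp_above_tangent[OF assms(1)]) auto
  then show ?thesis by simp
qed

lemma convex_deriv_mono:
  fixes l :: "real \<Rightarrow> real"
  assumes "convex_on UNIV l" "\<And>u. l differentiable (at u)" "u \<le> v"
  shows "deriv l u \<le> deriv l v"
proof (cases "u = v")
  case False
  \<comment> \<open>Sum of the tangent inequalities at \<open>u\<close> and at \<open>v\<close>, in
    which the values of \<open>l\<close> cancel.\<close>
  have "deriv l u * (v - u) \<le> deriv l v * (v - u)"
    using convex_deriv_lower[OF assms(1,2), of u v] convex_deriv_lower[OF assms(1,2), of v u]
    by (simp add: algebra_simps)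
  then show ?thesis using False assms(3) by simp
qed simp

locale smooth_convex_loss =
  fixes l :: "real \<Rightarrow> real" and M :: real
  assumes cvx: "convex_on UNIV l"
    and diff: "\<And>u. l differentiable (at u)"
    and diff2: "\<And>u. deriv l differentiable (at u)"
    and M_pos: "M > 0"
    and curv: "\<And>u. deriv (deriv l) u \<le> M"
begin

lemma DERIV_loss: "(l has_real_derivative deriv l u) (at u)"
  using diff by (simp add: DERIV_deriv_iff_real_differentiable)

lemma DERIV_slope: "(deriv l has_real_derivative deriv (deriv l) u) (at u)"
  using diff2 by (simp add: DERIV_deriv_iff_real_differentiable)

lemma complement_deriv: "((\<lambda>u. M * u\<^sup>2 / 2 - l u) has_real_derivative M * u - deriv l u) (at u)"
  by (auto intro!: derivative_eq_intros DERIV_loss)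

text \<open>Recasts the curvature bound as convexity, so that first-order facts on convex functions,
  applied to this complement, yield upper estimates of \<open>l\<close> and of its slope without a
  Taylor expansion.\<close>

lemma complement_convex: "convex_on UNIV (\<lambda>u. M * u\<^sup>2 / 2 - l u)"
proof (rule f''_ge0_imp_convex)
  show "((\<lambda>u. M * u\<^sup>2 / 2 - l u) has_real_derivative M * u - deriv l u) (at u)" for u
    by (rule complement_deriv)
  show "((\<lambda>u. M * u - deriv l u) has_real_derivative M - deriv (deriv l) u) (at u)" for u
    by (auto intro!: derivative_eq_intros DERIV_slope)
qed (use curv in auto)

text \<open>Tangent inequality of the complement at \<open>u\<close>; its quadratic terms combine to
  the square of \<open>v - u\<close>.\<close>

lemma tangent_upper: "l v \<le> l u + deriv l u * (v - u) + M * (v - u)\<^sup>2 / 2"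
proof -
  have "M * v\<^sup>2 / 2 - l v - (M * u\<^sup>2 / 2 - l u) \<ge> (M * u - deriv l u) * (v - u)"
    by (intro convex_on_imp_above_tangent[OF complement_convex])
      (auto intro: has_field_derivative_at_within complement_deriv)
  then show ?thesis by (simp add: field_simps power2_eq_square)
qed

text \<open>The slopes of \<open>l\<close> and of its complement are both nondecreasing, so for
  \<open>u \<le> v\<close> the increment of \<open>deriv l\<close> lies between 0 and
  \<open>M * (v - u)\<close>.\<close>

lemma slope_lipschitz: "\<bar>deriv l v - deriv l u\<bar> \<le> M * \<bar>v - u\<bar>"
proof -
  have *: "\<bar>deriv l v - deriv l u\<bar> \<le> M * \<bar>v - u\<bar>" if "u \<le> v" for u v
  proof -
    have "(\<lambda>u. M * u\<^sup>2 / 2 - l u) differentiable (at w)" for w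
      using complement_deriv real_differentiable_def by blast
    from convex_deriv_mono[OF complement_convex this that]
    have "M * u - deriv l u \<le> M * v - deriv l v"
      by (simp add: DERIV_imp_deriv[OF complement_deriv])
    moreover have "deriv l u \<le> deriv l v"
      by (rule convex_deriv_mono[OF cvx diff that])
    ultimately show ?thesis using that by (simp add: algebra_simps)
  qed
  show ?thesis
    using *[of u v] *[of v u] by (cases "u \<le> v") (auto simp: abs_minus_commute)
qed

lemma continuous_loss: "continuous_on UNIV l"
  by (intro continuous_at_imp_continuous_on ballI DERIV_isCont[OF DERIV_loss])

lemma continuous_slope: "continuous_on UNIV (deriv l)"
  by (intro continuous_at_imp_continuous_on ballI DERIV_isCont[OF DERIV_slope])

lemma borel_loss [measurable]: "l \<in> borel_measurable borel"
  using continuous_loss by (rule borel_measurable_continuous_onI)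

lemma borel_slope [measurable]: "deriv l \<in> borel_measurable borel"
  using continuous_slope by (rule borel_measurable_continuous_onI)

text \<open>The slope grows at most linearly, by the Lipschitz bound from 0. Its square is thus
  controlled by second moments, and the majorant also serves for dominated convergence.\<close>

lemma slope_sq_bound: "(deriv l u)\<^sup>2 \<le> 2 * (deriv l 0)\<^sup>2 + 2 * M\<^sup>2 * u\<^sup>2"
proof -
  have "\<bar>deriv l u - deriv l 0\<bar> \<le> M * \<bar>u\<bar>" using slope_lipschitz[of u 0] by simp
  then have "(deriv l u - deriv l 0)\<^sup>2 \<le> (M * \<bar>u\<bar>)\<^sup>2"
    using power_mono[of "\<bar>deriv l u - deriv l 0\<bar>" "M * \<bar>u\<bar>" 2] by simp
  moreover have "(deriv l u)\<^sup>2 \<le> 2 * (deriv l 0)\<^sup>2 + 2 * (deriv l u - deriv l 0)\<^sup>2"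
    using zero_le_power2[of "deriv l u - 2 * deriv l 0"]
    by (simp add: power2_eq_square algebra_simps)
  ultimately show ?thesis by (simp add: power_mult_distrib)
qed

text \<open>The lower and upper tangent bounds at 0 enclose \<open>l u\<close>; the linear term is
  traded for a quadratic one to get an integrable majorant.\<close>

lemma loss_bound: "\<bar>l u\<bar> \<le> \<bar>l 0\<bar> + \<bar>deriv l 0\<bar> * (1 + u\<^sup>2) + M * u\<^sup>2 / 2"
proof -
  have "l 0 + deriv l 0 * u \<le> l u" using convex_deriv_lower[OF cvx diff, of 0 u] by simp
  moreover have "l u \<le> l 0 + deriv l 0 * u + M * u\<^sup>2 / 2" using tangent_upper[of u 0] by simp
  moreover have "\<bar>deriv l 0 * u\<bar> \<le> \<bar>deriv l 0\<bar> * (1 + u\<^sup>2)"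
  proof -
    have "2 * \<bar>u\<bar> \<le> 1 + u\<^sup>2"
      using zero_le_power2[of "\<bar>u\<bar> - 1"] by (simp add: power2_eq_square algebra_simps)
    then have "\<bar>u\<bar> \<le> 1 + u\<^sup>2" by linarith
    then show ?thesis by (simp add: abs_mult mult_left_mono)
  qed
  moreover have "M * u\<^sup>2 / 2 \<ge> 0" using M_pos by simp
  ultimately show ?thesis by linarith
qed

end

section \<open>Spectral bounds for the inverse quadratic form\<close>

lemma matrix_inv_right:
  fixes Q :: "real^'n^'n"
  assumes "invertible Q"
  shows "Q ** matrix_inv Q = mat 1"
proof -
  have "\<exists>Q'. Q ** Q' = mat 1 \<and> Q' ** Q = mat 1"
    using assms by (simp add: invertible_def)
  from someI_ex[OF this] show ?thesis by (simp add: matrix_inv_def)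
qed

lemma sym_pos_def_invertible:
  assumes "sym_pos_def Q"
  shows "invertible Q"
proof -
  have "v = 0" if "Q *v v = 0" for v
    using assms that unfolding sym_pos_def_def by force
  then show ?thesis
    by (simp add: invertible_left_inverse matrix_left_invertible_ker)
qed

lemma quadratic_form_bounds:
  fixes Q :: "real^'n^'n"
  assumes "\<And>v. norm v = 1 \<Longrightarrow> r \<le> v \<bullet> (Q *v v) \<and> v \<bullet> (Q *v v) \<le> R"
  shows "r * (norm v)\<^sup>2 \<le> v \<bullet> (Q *v v)" "v \<bullet> (Q *v v) \<le> R * (norm v)\<^sup>2"
proof -
  have "r * (norm v)\<^sup>2 \<le> v \<bullet> (Q *v v) \<and> v \<bullet> (Q *v v) \<le> R * (norm v)\<^sup>2"
  proof (cases "v = 0")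
    case False
    define w where "w = v /\<^sub>R norm v"
    have w: "norm w = 1" "v = norm v *\<^sub>R w" using False by (auto simp: w_def)
    have "v \<bullet> (Q *v v) = (norm v)\<^sup>2 * (w \<bullet> (Q *v w))"
      by (subst (1 2) w(2)) (simp add: matrix_vector_mult_scaleR power2_eq_square)
    then show ?thesis
      using assms[OF w(1)] by (simp add: mult.commute[of _ "(norm v)\<^sup>2"] mult_left_mono)
  qed auto
  then show "r * (norm v)\<^sup>2 \<le> v \<bullet> (Q *v v)" "v \<bullet> (Q *v v) \<le> R * (norm v)\<^sup>2" by auto
qed

text \<open>Avoids diagonalization: with \<open>w\<close> the solution of
  \<open>A x *v w = \<beta>\<close>, the inverse form equals both \<open>w \<bullet> \<beta>\<close>
  and the form of \<open>A x\<close> at \<open>w\<close>. Each bound then comes from one nonnegative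
  quadratic expression in \<open>w\<close> and \<open>\<beta>\<close>.\<close>

lemma inv_form_bounds:
  fixes A :: "real^'n \<Rightarrow> real^'n^'n"
  assumes "sym_pos_def (A x)" "r > 0" "R > 0"
    and "\<And>v. norm v = 1 \<Longrightarrow> r \<le> v \<bullet> (A x *v v) \<and> v \<bullet> (A x *v v) \<le> R"
  shows "(norm \<beta>)\<^sup>2 / R \<le> inv_form A \<beta> x" "inv_form A \<beta> x \<le> (norm \<beta>)\<^sup>2 / r"
proof -
  let ?Q = "A x"
  note form = quadratic_form_bounds[OF assms(4)]
  define w where "w = matrix_inv ?Q *v \<beta>"
  define q where "q = inv_form A \<beta> x"
  have Qw: "?Q *v w = \<beta>"
    by (simp add: w_def matrix_vector_mul_assoc matrix_inv_right
        sym_pos_def_invertible[OF assms(1)])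
  have q1: "q = w \<bullet> \<beta>" by (simp add: q_def inv_form_def w_def inner_commute)
  have q2: "q = w \<bullet> (?Q *v w)" by (simp add: q1 Qw)
  have sym: "w \<bullet> (?Q *v \<beta>) = (norm \<beta>)\<^sup>2"
  proof -
    have "w \<bullet> (?Q *v \<beta>) = (transpose ?Q *v w) \<bullet> \<beta>"
      by (simp add: dot_lmul_matrix transpose_matrix_vector)
    also have "\<dots> = \<beta> \<bullet> \<beta>" using assms(1) Qw by (simp add: sym_pos_def_def)
    finally show ?thesis by (simp add: dot_square_norm)
  qed
  show "(norm \<beta>)\<^sup>2 / R \<le> inv_form A \<beta> x"
  proof -
    \<comment> \<open>The shift \<open>\<beta> / R\<close> is what \<open>w\<close> would be if
      \<open>A x\<close> were \<open>R\<close> times the identity, the case of equality.\<close>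
    have "0 \<le> r * (norm (w - (1 / R) *\<^sub>R \<beta>))\<^sup>2" using assms(2) by simp
    also have "\<dots> \<le> (w - (1 / R) *\<^sub>R \<beta>) \<bullet> (?Q *v (w - (1 / R) *\<^sub>R \<beta>))" by (rule form)
    also have "\<dots> = q - 2 * (norm \<beta>)\<^sup>2 / R + (\<beta> \<bullet> (?Q *v \<beta>)) / R\<^sup>2"
      using assms(3)
      by (simp add: matrix_vector_mult_diff_distrib matrix_vector_mult_scaleR Qw q1 sym
          inner_diff_left inner_diff_right dot_square_norm field_simps power2_eq_square)
    also have "(\<beta> \<bullet> (?Q *v \<beta>)) / R\<^sup>2 \<le> (R * (norm \<beta>)\<^sup>2) / R\<^sup>2"
      by (intro divide_right_mono form zero_le_power2)
    also have "(R * (norm \<beta>)\<^sup>2) / R\<^sup>2 = (norm \<beta>)\<^sup>2 / R"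
      using assms(3) by (simp add: power2_eq_square)
    finally show ?thesis by (simp add: q_def)
  qed
  show "inv_form A \<beta> x \<le> (norm \<beta>)\<^sup>2 / r"
  proof -
    \<comment> \<open>Expand the squared norm of \<open>r *\<^sub>R w - \<beta>\<close> and bound
      its leading term by \<open>r * q\<close>, using the lower spectral bound at
      \<open>w\<close>.\<close>
    have "r * q \<ge> 2 * r * q - (norm \<beta>)\<^sup>2"
    proof -
      have "0 \<le> (norm (r *\<^sub>R w - \<beta>))\<^sup>2" by simp
      also have "\<dots> = r\<^sup>2 * (norm w)\<^sup>2 - 2 * r * q + (norm \<beta>)\<^sup>2"
        unfolding power2_norm_eq_inner
        by (simp add: inner_diff_left inner_diff_right q1 inner_commute power2_eq_square
            algebra_simps)
      also have "r\<^sup>2 * (norm w)\<^sup>2 \<le> r * q"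
        using mult_left_mono[OF form(1)[of w], of r] assms(2) by (simp add: q2 power2_eq_square)
      finally show ?thesis by simp
    qed
    then show ?thesis using assms(2) by (simp add: q_def field_simps)
  qed
qed

section \<open>Extended-real expectations\<close>

text \<open>The nonnegative integral is monotone on arbitrary functions, so this applies directly to
  \<open>l_rob\<close>, a supremum over uncountably many \<open>\<gamma>\<close>.\<close>

lemma ereal_expectation_mono:
  assumes "AE x in P. f x \<le> g x"
  shows "ereal_expectation P f \<le> ereal_expectation P g"
  unfolding ereal_expectation_def
proof (rule ereal_minus_mono)
  show "enn2ereal (\<integral>\<^sup>+ x. e2ennreal (f x) \<partial>P) \<le> enn2ereal (\<integral>\<^sup>+ x. e2ennreal (g x) \<partial>P)"
    using assms by (auto simp: less_eq_ennreal.rep_eq[symmetric]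
        intro!: nn_integral_mono_AE e2ennreal_mono elim!: eventually_mono)
  show "enn2ereal (\<integral>\<^sup>+ x. e2ennreal (- g x) \<partial>P) \<le> enn2ereal (\<integral>\<^sup>+ x. e2ennreal (- f x) \<partial>P)"
    using assms by (auto simp: less_eq_ennreal.rep_eq[symmetric]
        intro!: nn_integral_mono_AE e2ennreal_mono elim!: eventually_mono)
qed

lemma ereal_expectation_integrable:
  assumes "integrable P g"
  shows "ereal_expectation P (\<lambda>x. ereal (g x)) = ereal (\<integral>x. g x \<partial>P)"
proof -
  have "(\<integral>\<^sup>+ x. ennreal (g x) \<partial>P) < \<infinity>" "(\<integral>\<^sup>+ x. ennreal (- g x) \<partial>P) < \<infinity>"
    using assms by (auto simp: real_integrable_def top.not_eq_extremum)
  then show ?thesis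
    unfolding ereal_expectation_def real_lebesgue_integral_def[OF assms]
    by (cases "\<integral>\<^sup>+ x. ennreal (g x) \<partial>P" rule: ennreal_cases;
        cases "\<integral>\<^sup>+ x. ennreal (- g x) \<partial>P" rule: ennreal_cases)
      (auto simp: e2ennreal_ereal enn2ereal_ennreal)
qed

section \<open>Pointwise bounds of the robust loss\<close>

context smooth_convex_loss
begin

text \<open>A single well-chosen \<open>\<gamma>\<close> bounds the supremum from below. The
  separate positive \<open>\<mu>\<close> permits \<open>lam = 0\<close>, and \<open>p\<close> stands
  for a bound of the inverse form that is uniform in \<open>x\<close>.\<close>

lemma l_rob_lower:
  assumes "\<delta> > 0" "0 \<le> lam" "lam \<le> \<mu>" "\<mu> > 0" "0 \<le> p" "p \<le> inv_form A \<beta> x"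
  shows "ereal (l (\<beta> \<bullet> x) + lam * sqrt \<delta> + sqrt \<delta> * p / (4 * \<mu>) * (deriv l (\<beta> \<bullet> x))\<^sup>2)
    \<le> l_rob \<delta> l A \<beta> lam x"
proof -
  define h where "h = deriv l (\<beta> \<bullet> x)"
  define q where "q = inv_form A \<beta> x"
  define s where "s = sqrt \<delta>"
  \<comment> \<open>Maximizer of \<open>h * \<gamma> - \<mu> * \<gamma>\<^sup>2\<close>, the
    parabola left when \<open>l\<close> is replaced by its tangent and \<open>lam\<close> by
    \<open>\<mu>\<close>.\<close>
  define \<gamma> where "\<gamma> = h / (2 * \<mu>)"
  have s: "s > 0" and q: "q \<ge> p" "q \<ge> 0" using assms by (auto simp: s_def q_def)
  have "s * p / (4 * \<mu>) * h\<^sup>2 \<le> s * q / (4 * \<mu>) * h\<^sup>2"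
    using s q assms(4) by (intro mult_right_mono divide_right_mono mult_left_mono) auto
  also have "\<dots> = h * (\<gamma> * s * q) - \<mu> * s * (\<gamma>\<^sup>2 * q)"
    using assms(4) by (simp add: \<gamma>_def field_simps power2_eq_square)
  also have "\<dots> \<le> h * (\<gamma> * s * q) - lam * s * (\<gamma>\<^sup>2 * q)"
    using s q assms(3) by (intro diff_left_mono mult_right_mono) auto
  also have "h * (\<gamma> * s * q) \<le> l (\<beta> \<bullet> x + \<gamma> * s * q) - l (\<beta> \<bullet> x)"
    using convex_deriv_lower[OF cvx diff, of "\<beta> \<bullet> x" "\<beta> \<bullet> x + \<gamma> * s * q"] by (simp add: h_def)
  finally have "l (\<beta> \<bullet> x) + lam * s + s * p / (4 * \<mu>) * h\<^sup>2 \<le> F_obj \<delta> l A \<gamma> \<beta> lam x"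
    by (simp add: F_obj_def s_def q_def algebra_simps)
  then show ?thesis
    unfolding l_rob_def h_def s_def by (intro SUP_upper2[of \<gamma>]) auto
qed

text \<open>The first summand of \<open>lam\<close> absorbs the curvature term of the quadratic
  upper bound. The second, \<open>b\<close>, keeps the remaining parabola in \<open>\<gamma>\<close>
  concave, and choosing it of the order of \<open>norm \<beta>\<close> makes its maximum of that
  order too.\<close>

lemma l_rob_upper:
  assumes "\<delta> > 0" "0 \<le> inv_form A \<beta> x" "inv_form A \<beta> x \<le> b\<^sup>2 / r" "r > 0" "b \<ge> 0"
    and lam: "lam = M * sqrt \<delta> * b\<^sup>2 / (2 * r) + b"
  shows "l_rob \<delta> l A \<beta> lam x
    \<le> ereal (l (\<beta> \<bullet> x) + lam * sqrt \<delta> + sqrt \<delta> * b / (4 * r) * (deriv l (\<beta> \<bullet> x))\<^sup>2)"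
  unfolding l_rob_def
proof (rule SUP_least)
  fix \<gamma>
  define h where "h = deriv l (\<beta> \<bullet> x)"
  define q where "q = inv_form A \<beta> x"
  define s where "s = sqrt \<delta>"
  have s: "s > 0" and q: "q \<ge> 0" "q \<le> b\<^sup>2 / r" using assms by (auto simp: s_def q_def)
  have "M * s * q / 2 \<le> M * s * (b\<^sup>2 / r) / 2"
    using q s M_pos by (intro divide_right_mono mult_left_mono) auto
  then have lam': "M * s * q / 2 + b \<le> lam" by (simp add: lam s_def)
  have "l (\<beta> \<bullet> x + \<gamma> * s * q) \<le> l (\<beta> \<bullet> x) + h * (\<gamma> * s * q) + M * (\<gamma> * s * q)\<^sup>2 / 2"
    using tangent_upper[of "\<beta> \<bullet> x + \<gamma> * s * q" "\<beta> \<bullet> x"] by (simp add: h_def)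
  moreover have "(M * s * q / 2 + b) * (s * \<gamma>\<^sup>2 * q) \<le> lam * (s * \<gamma>\<^sup>2 * q)"
    using lam' s q by (intro mult_right_mono) auto
  moreover have "s * (q * (h * \<gamma> - b * \<gamma>\<^sup>2)) \<le> s * (b / (4 * r) * h\<^sup>2)"
  proof (intro mult_left_mono)
    show "q * (h * \<gamma> - b * \<gamma>\<^sup>2) \<le> b / (4 * r) * h\<^sup>2"
    \<comment> \<open>For \<open>b = 0\<close> the bound on \<open>q\<close> forces
      \<open>q = 0\<close>; otherwise completing the square gives the maximum
      \<open>h\<^sup>2 / (4 * b)\<close>.\<close>
    proof (cases "b = 0")
      case False
      then have b: "b > 0" using assms by simp
      have "0 \<le> (h - 2 * b * \<gamma>)\<^sup>2" by simp
      then have "4 * b * (h * \<gamma> - b * \<gamma>\<^sup>2) \<le> h\<^sup>2"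
        by (simp add: power2_eq_square algebra_simps)
      then have "h * \<gamma> - b * \<gamma>\<^sup>2 \<le> h\<^sup>2 / (4 * b)" using b by (simp add: field_simps)
      then have "q * (h * \<gamma> - b * \<gamma>\<^sup>2) \<le> q * (h\<^sup>2 / (4 * b))" using q by (intro mult_left_mono)
      also have "\<dots> \<le> b\<^sup>2 / r * (h\<^sup>2 / (4 * b))" using q b by (intro mult_right_mono) auto
      also have "\<dots> = b / (4 * r) * h\<^sup>2" using b by (simp add: power2_eq_square)
      finally show ?thesis .
    qed (use q in auto)
  qed (use s in auto)
  ultimately have "F_obj \<delta> l A \<gamma> \<beta> lam x \<le> l (\<beta> \<bullet> x) + lam * s + s * b / (4 * r) * h\<^sup>2"
    by (simp add: F_obj_def s_def[symmetric] q_def[symmetric] algebra_simps power2_eq_square)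
  then show "ereal (F_obj \<delta> l A \<gamma> \<beta> lam x)
    \<le> ereal (l (\<beta> \<bullet> x) + lam * sqrt \<delta> + sqrt \<delta> * b / (4 * r) * (deriv l (\<beta> \<bullet> x))\<^sup>2)"
    by (simp add: h_def s_def)
qed

end

section \<open>Integrability and the slope norm over a compact set\<close>

locale smooth_convex_model = smooth_convex_loss l M + prob_space P0
  for l :: "real \<Rightarrow> real" and M :: real and P0 :: "(real^'n) measure" +
  assumes sets_P0 [measurable_cong, simp]: "sets P0 = sets borel"
    and fourth_moment: "integrable P0 (\<lambda>x. norm x ^ 4)"
begin

lemma second_moment: "integrable P0 (\<lambda>x. (norm x)\<^sup>2)"
proof (rule Bochner_Integration.integrable_bound)
  show "integrable P0 (\<lambda>x. 1 + norm x ^ 4)" using fourth_moment by simp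
  have "y\<^sup>2 \<le> 1 + y ^ 4" for y :: real
    using zero_le_power2[of "y\<^sup>2 - 1"] zero_le_power2[of "y\<^sup>2"]
    by (simp add: power2_eq_square algebra_simps power4_eq_xxxx)
  then show "AE x in P0. norm ((norm x)\<^sup>2) \<le> norm (1 + norm x ^ 4)" by simp
qed measurable

lemma inner_sq_le: "(\<beta> \<bullet> x)\<^sup>2 \<le> (norm \<beta>)\<^sup>2 * (norm x)\<^sup>2" for \<beta> x :: "real^'n"
  using Cauchy_Schwarz_ineq[of \<beta> x] by (simp add: power2_norm_eq_inner)

lemma integrable_inner_sq: "integrable P0 (\<lambda>x. (\<beta> \<bullet> x)\<^sup>2)"
  by (rule Bochner_Integration.integrable_bound[of _ "\<lambda>x. (norm \<beta>)\<^sup>2 * (norm x)\<^sup>2"])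
    (use second_moment inner_sq_le in auto)

lemma integrable_loss: "integrable P0 (\<lambda>x. l (\<beta> \<bullet> x))"
proof (rule Bochner_Integration.integrable_bound)
  show "integrable P0 (\<lambda>x. \<bar>l 0\<bar> + \<bar>deriv l 0\<bar> * (1 + (\<beta> \<bullet> x)\<^sup>2) + M * (\<beta> \<bullet> x)\<^sup>2 / 2)"
    using integrable_inner_sq by simp
  show "AE x in P0. norm (l (\<beta> \<bullet> x))
      \<le> norm (\<bar>l 0\<bar> + \<bar>deriv l 0\<bar> * (1 + (\<beta> \<bullet> x)\<^sup>2) + M * (\<beta> \<bullet> x)\<^sup>2 / 2)"
    using loss_bound by (auto intro: order_trans[OF loss_bound abs_ge_self])
qed measurable

lemma integrable_slope_sq: "integrable P0 (\<lambda>x. (deriv l (\<beta> \<bullet> x))\<^sup>2)"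
proof (rule Bochner_Integration.integrable_bound)
  show "integrable P0 (\<lambda>x. 2 * (deriv l 0)\<^sup>2 + 2 * M\<^sup>2 * (\<beta> \<bullet> x)\<^sup>2)"
    using integrable_inner_sq by simp
  show "AE x in P0. norm ((deriv l (\<beta> \<bullet> x))\<^sup>2)
      \<le> norm (2 * (deriv l 0)\<^sup>2 + 2 * M\<^sup>2 * (\<beta> \<bullet> x)\<^sup>2)"
    by (auto intro!: slope_sq_bound)
qed measurable

lemma slope_norm_sq: "(slope_norm P0 l \<beta>)\<^sup>2 = (\<integral>x. (deriv l (\<beta> \<bullet> x))\<^sup>2 \<partial>P0)"
  by (simp add: slope_norm_def)

lemma slope_norm_pos:
  assumes "\<not> (AE x in P0. deriv l (\<beta> \<bullet> x) = 0)"
  shows "slope_norm P0 l \<beta> > 0"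
proof -
  have "(\<integral>x. (deriv l (\<beta> \<bullet> x))\<^sup>2 \<partial>P0) \<noteq> 0"
    using assms by (simp add: integral_nonneg_eq_0_iff_AE[OF integrable_slope_sq])
  moreover have "(\<integral>x. (deriv l (\<beta> \<bullet> x))\<^sup>2 \<partial>P0) \<ge> 0" by simp
  ultimately have "(\<integral>x. (deriv l (\<beta> \<bullet> x))\<^sup>2 \<partial>P0) > 0" by linarith
  then show ?thesis unfolding slope_norm_def by simp
qed

text \<open>Dominated convergence: a convergent sequence of parameters is bounded, which gives one
  majorant quadratic in \<open>norm x\<close>. Together with compactness of \<open>B\<close> this
  controls \<open>slope_min\<close> and \<open>slope_max\<close>.\<close>

lemma continuous_slope_norm: "continuous_on (UNIV :: (real^'n) set) (slope_norm P0 l)"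
proof (rule continuous_on_sequentiallyI)
  fix b :: "nat \<Rightarrow> real^'n" and \<beta> assume b: "b \<longlonglongrightarrow> \<beta>"
  obtain C where C: "\<And>n. norm (b n) \<le> C"
    using convergent_imp_Bseq[OF convergentI[OF b]] unfolding Bseq_def by blast
  have "(\<lambda>n. \<integral>x. (deriv l (b n \<bullet> x))\<^sup>2 \<partial>P0) \<longlonglongrightarrow> (\<integral>x. (deriv l (\<beta> \<bullet> x))\<^sup>2 \<partial>P0)"
  proof (rule integral_dominated_convergence)
    show "integrable P0 (\<lambda>x. 2 * (deriv l 0)\<^sup>2 + 2 * M\<^sup>2 * (C\<^sup>2 * (norm x)\<^sup>2))"
      using second_moment by simp
    have "isCont (deriv l) u" for u using DERIV_isCont[OF DERIV_slope] .
    then show "AE x in P0. (\<lambda>n. (deriv l (b n \<bullet> x))\<^sup>2) \<longlonglongrightarrow> (deriv l (\<beta> \<bullet> x))\<^sup>2"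
      using b by (intro AE_I2 tendsto_power isCont_tendsto_compose[of _ "deriv l"]
          tendsto_inner tendsto_const)
    show "AE x in P0. norm ((deriv l (b n \<bullet> x))\<^sup>2)
        \<le> 2 * (deriv l 0)\<^sup>2 + 2 * M\<^sup>2 * (C\<^sup>2 * (norm x)\<^sup>2)" for n
    proof (rule AE_I2)
      fix x
      have "(b n \<bullet> x)\<^sup>2 \<le> (norm (b n))\<^sup>2 * (norm x)\<^sup>2" by (rule inner_sq_le)
      also have "\<dots> \<le> C\<^sup>2 * (norm x)\<^sup>2" using C by (intro mult_right_mono power_mono) auto
      finally have "2 * M\<^sup>2 * (b n \<bullet> x)\<^sup>2 \<le> 2 * M\<^sup>2 * (C\<^sup>2 * (norm x)\<^sup>2)"
        by (intro mult_left_mono) auto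
      then show "norm ((deriv l (b n \<bullet> x))\<^sup>2)
          \<le> 2 * (deriv l 0)\<^sup>2 + 2 * M\<^sup>2 * (C\<^sup>2 * (norm x)\<^sup>2)"
        using slope_sq_bound[of "b n \<bullet> x"] by simp
    qed
  qed measurable
  then show "(\<lambda>n. slope_norm P0 l (b n)) \<longlonglongrightarrow> slope_norm P0 l \<beta>"
    unfolding slope_norm_def by (rule tendsto_real_sqrt)
qed

text \<open>Real \<open>INF\<close> and \<open>SUP\<close> bound the values only if these are
  bounded; compactness of the continuous image supplies that.\<close>

lemma slope_norm_bounds:
  assumes "compact B" "\<beta> \<in> B"
  shows "slope_min P0 l B \<le> slope_norm P0 l \<beta>" "slope_norm P0 l \<beta> \<le> slope_max P0 l B"
proof -
  have "compact (slope_norm P0 l ` B)"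
    using continuous_on_subset[OF continuous_slope_norm] assms(1)
    by (intro compact_continuous_image) auto
  then have "bounded (slope_norm P0 l ` B)" by (rule compact_imp_bounded)
  then show "slope_min P0 l B \<le> slope_norm P0 l \<beta>" "slope_norm P0 l \<beta> \<le> slope_max P0 l B"
    unfolding slope_min_def slope_max_def
    using assms(2) by (auto intro!: cINF_lower cSUP_upper bounded_imp_bdd_below bounded_imp_bdd_above)
qed

text \<open>Compactness makes the infimum attained, so positivity at each single
  \<open>\<beta>\<close> passes to it.\<close>

lemma slope_min_pos:
  assumes "compact B" "B \<noteq> {}" "\<And>\<beta>. \<beta> \<in> B \<Longrightarrow> \<not> (AE x in P0. deriv l (\<beta> \<bullet> x) = 0)"
  shows "slope_min P0 l B > 0"
proof -
  obtain \<beta> where "\<beta> \<in> B" "\<forall>\<beta>'\<in>B. slope_norm P0 l \<beta> \<le> slope_norm P0 l \<beta>'"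
    using continuous_attains_inf[OF assms(1,2) continuous_on_subset[OF continuous_slope_norm]]
    by auto
  then have "slope_norm P0 l \<beta> \<le> slope_min P0 l B"
    unfolding slope_min_def using assms(2) by (intro cINF_greatest) auto
  then show ?thesis using slope_norm_pos[OF assms(3)[OF \<open>\<beta> \<in> B\<close>]] by linarith
qed

section \<open>Bounds for dual optimizers\<close>

lemma expectation_loss_slope:
  "ereal_expectation P0 (\<lambda>x. ereal (l (\<beta> \<bullet> x) + c + k * (deriv l (\<beta> \<bullet> x))\<^sup>2))
    = ereal ((\<integral>x. l (\<beta> \<bullet> x) \<partial>P0) + c + k * (slope_norm P0 l \<beta>)\<^sup>2)"
  using integrable_loss[of \<beta>] integrable_slope_sq[of \<beta>]
  by (subst ereal_expectation_integrable) (auto simp: slope_norm_sq prob_space)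

text \<open>Integrating the pointwise bounds encloses the dual objective: its lower bound at
  \<open>lam\<close> cannot exceed its upper bound at the trial value \<open>lam0\<close>.\<close>

lemma dual_optimizer_inequality:
  fixes A :: "real^'n \<Rightarrow> real^'n^'n"
  assumes "\<delta> > 0" "\<And>x. sym_pos_def (A x)" "\<rho>min > 0" "\<rho>max > 0"
    and spectrum: "AE x in P0. \<forall>v. norm v = 1 \<longrightarrow>
      \<rho>min \<le> v \<bullet> (A x *v v) \<and> v \<bullet> (A x *v v) \<le> \<rho>max"
    and opt: "is_arg_min (f_dual P0 \<delta> l A \<beta>) (\<lambda>s. s \<ge> 0) lam"
    and \<mu>: "lam \<le> \<mu>" "\<mu> > 0"
  shows "lam + (norm \<beta>)\<^sup>2 * (slope_norm P0 l \<beta>)\<^sup>2 / (4 * \<rho>max * \<mu>)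
    \<le> norm \<beta> * (M * sqrt \<delta> * norm \<beta> / (2 * \<rho>min) + 1 + (slope_norm P0 l \<beta>)\<^sup>2 / (4 * \<rho>min))"
proof -
  define b where "b = norm \<beta>"
  define lam0 where "lam0 = M * sqrt \<delta> * b\<^sup>2 / (2 * \<rho>min) + b"
  have b: "b \<ge> 0" and lam: "lam \<ge> 0" using opt by (auto simp: b_def is_arg_min_def)
  have lam0: "lam0 \<ge> 0" using M_pos assms(1,3) b by (simp add: lam0_def)
  have q: "AE x in P0. b\<^sup>2 / \<rho>max \<le> inv_form A \<beta> x \<and> inv_form A \<beta> x \<le> b\<^sup>2 / \<rho>min"
    using spectrum unfolding b_def
    by eventually_elim (use inv_form_bounds assms(2,3,4) in blast)
  let ?E = "\<integral>x. l (\<beta> \<bullet> x) \<partial>P0"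
  let ?S = "(slope_norm P0 l \<beta>)\<^sup>2"
  have nonneg: "b\<^sup>2 / \<rho>max \<ge> 0" using assms(4) by simp
  have "ereal (?E + lam * sqrt \<delta> + sqrt \<delta> * (b\<^sup>2 / \<rho>max) / (4 * \<mu>) * ?S) \<le> f_dual P0 \<delta> l A \<beta> lam"
    unfolding f_dual_def expectation_loss_slope[symmetric]
  proof (rule ereal_expectation_mono)
    show "AE x in P0. ereal (l (\<beta> \<bullet> x) + lam * sqrt \<delta>
        + sqrt \<delta> * (b\<^sup>2 / \<rho>max) / (4 * \<mu>) * (deriv l (\<beta> \<bullet> x))\<^sup>2) \<le> l_rob \<delta> l A \<beta> lam x"
      using q
    proof eventually_elim
      case (elim x)
      then show ?case
        by (intro l_rob_lower assms(1) lam \<mu> nonneg) simp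
    qed
  qed
  also have "\<dots> \<le> f_dual P0 \<delta> l A \<beta> lam0"
    using opt lam0 by (auto simp: is_arg_min_def not_less)
  also have "\<dots> \<le> ereal (?E + lam0 * sqrt \<delta> + sqrt \<delta> * b / (4 * \<rho>min) * ?S)"
    unfolding f_dual_def expectation_loss_slope[symmetric]
  proof (rule ereal_expectation_mono)
    show "AE x in P0. l_rob \<delta> l A \<beta> lam0 x
        \<le> ereal (l (\<beta> \<bullet> x) + lam0 * sqrt \<delta> + sqrt \<delta> * b / (4 * \<rho>min) * (deriv l (\<beta> \<bullet> x))\<^sup>2)"
      using q
    proof eventually_elim
      case (elim x)
      then show ?case
        using nonneg by (intro l_rob_upper assms(1,3) b lam0_def) auto
    qed
  qed
  \<comment> \<open>Both ends of the chain are finite, so the expected loss \<open>?E\<close>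
    cancels.\<close>
  finally have "sqrt \<delta> * (lam + b\<^sup>2 * ?S / (4 * \<rho>max * \<mu>)) \<le> sqrt \<delta> * (lam0 + b * ?S / (4 * \<rho>min))"
    by (simp add: algebra_simps)
  then have "lam + b\<^sup>2 * ?S / (4 * \<rho>max * \<mu>) \<le> lam0 + b * ?S / (4 * \<rho>min)"
    using assms(1) by simp
  also have "\<dots> = b * (M * sqrt \<delta> * b / (2 * \<rho>min) + 1 + ?S / (4 * \<rho>min))"
    by (simp add: lam0_def algebra_simps power2_eq_square)
  finally show ?thesis unfolding b_def .
qed

text \<open>Replacing \<open>norm \<beta>\<close> and the slope norm by \<open>R\<close>,
  \<open>s\<close> and \<open>S\<close> inside the constants makes \<open>D\<close> uniform in
  \<open>\<beta>\<close>. Dropping the fraction then bounds \<open>lam\<close> from above, and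
  dropping \<open>lam\<close> bounds it from below.\<close>

lemma dual_optimizer_bounds:
  fixes A :: "real^'n \<Rightarrow> real^'n^'n"
  assumes "\<delta> > 0" "\<And>x. sym_pos_def (A x)" "\<rho>min > 0" "\<rho>max > 0"
    and spectrum: "AE x in P0. \<forall>v. norm v = 1 \<longrightarrow>
      \<rho>min \<le> v \<bullet> (A x *v v) \<and> v \<bullet> (A x *v v) \<le> \<rho>max"
    and opt: "is_arg_min (f_dual P0 \<delta> l A \<beta>) (\<lambda>s. s \<ge> 0) lam"
    and R: "norm \<beta> \<le> R" and S: "0 \<le> s" "s \<le> slope_norm P0 l \<beta>" "slope_norm P0 l \<beta> \<le> S"
    and D: "D = M * sqrt \<delta> * R / (2 * \<rho>min) + 1 + S\<^sup>2 / (4 * \<rho>min)"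
  shows "s\<^sup>2 / (4 * \<rho>max * D) * norm \<beta> \<le> lam" "lam \<le> D * norm \<beta>"
proof -
  have lam: "lam \<ge> 0" using opt by (simp add: is_arg_min_def)
  have "norm \<beta> \<ge> 0" by simp
  then have "R \<ge> 0" using R by linarith
  then have "M * sqrt \<delta> * R / (2 * \<rho>min) \<ge> 0" "S\<^sup>2 / (4 * \<rho>min) \<ge> 0"
    using M_pos assms(1,3) by simp_all
  then have Dpos: "D > 0" unfolding D by linarith
  have ineq: "lam + (norm \<beta>)\<^sup>2 * s\<^sup>2 / (4 * \<rho>max * \<mu>) \<le> D * norm \<beta>" if "lam \<le> \<mu>" "\<mu> > 0" for \<mu>
  proof -
    have "lam + (norm \<beta>)\<^sup>2 * s\<^sup>2 / (4 * \<rho>max * \<mu>)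
        \<le> lam + (norm \<beta>)\<^sup>2 * (slope_norm P0 l \<beta>)\<^sup>2 / (4 * \<rho>max * \<mu>)"
      using that assms(4) S by (intro add_left_mono divide_right_mono mult_left_mono power_mono) auto
    also have "\<dots> \<le> norm \<beta> * (M * sqrt \<delta> * norm \<beta> / (2 * \<rho>min) + 1
        + (slope_norm P0 l \<beta>)\<^sup>2 / (4 * \<rho>min))"
      using dual_optimizer_inequality[OF assms(1-4) spectrum opt that] .
    also have "\<dots> \<le> norm \<beta> * D"
      unfolding D
    proof (intro mult_left_mono add_mono divide_right_mono power_mono)
      show "norm \<beta> \<le> R" "slope_norm P0 l \<beta> \<le> S" "0 \<le> slope_norm P0 l \<beta>"
        using R S by linarith+
    qed (use M_pos assms(1,3) in simp_all)
    finally show ?thesis by (simp add: mult.commute)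
  qed
  show "lam \<le> D * norm \<beta>"
  proof -
    \<comment> \<open>Any positive \<open>\<mu>\<close> above \<open>lam\<close> would serve;
      \<open>lam + 1\<close> is one.\<close>
    have "0 \<le> (norm \<beta>)\<^sup>2 * s\<^sup>2 / (4 * \<rho>max * (lam + 1))" using lam assms(4) by simp
    then show ?thesis using ineq[of "lam + 1"] lam by linarith
  qed
  show "s\<^sup>2 / (4 * \<rho>max * D) * norm \<beta> \<le> lam"
  \<comment> \<open>\<open>lam\<close> may be 0 at this stage and cannot itself be taken as
    \<open>\<mu>\<close>; the bound is shown for every \<open>\<mu>\<close> above it
    instead.\<close>
  proof (rule dense_ge)
    fix \<mu> assume "lam < \<mu>"
    then have \<mu>: "\<mu> > 0" using lam by simp
    have "(norm \<beta>)\<^sup>2 * s\<^sup>2 / (4 * \<rho>max * \<mu>) \<le> D * norm \<beta>"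
      using ineq[of \<mu>] \<open>lam < \<mu>\<close> lam by linarith
    then have "norm \<beta> * (norm \<beta> * s\<^sup>2 / (4 * \<rho>max * \<mu>)) \<le> norm \<beta> * D"
      by (simp add: power2_eq_square mult_ac)
    then show "s\<^sup>2 / (4 * \<rho>max * D) * norm \<beta> \<le> \<mu>"
    proof (cases "\<beta> = 0")
      case False
      then have "norm \<beta> * s\<^sup>2 / (4 * \<rho>max * \<mu>) \<le> D"
        using mult_left_le_imp_le[OF \<open>norm \<beta> * _ \<le> norm \<beta> * D\<close>] by simp
      then have "norm \<beta> * s\<^sup>2 \<le> D * (4 * \<rho>max * \<mu>)"
        using \<mu> assms(4) by (simp add: pos_divide_le_eq)
      then show ?thesis using Dpos assms(4) by (simp add: pos_divide_le_eq mult_ac)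
    qed (use \<mu> in simp)
  qed
qed

end

section \<open>Explicit constants, uniform in the parameter\<close>

theorem proposition1:
  shows "\<exists>k1 k2 :: real \<Rightarrow> real \<Rightarrow> real \<Rightarrow> real \<Rightarrow> real \<Rightarrow> real \<Rightarrow> real \<Rightarrow> real.
    \<forall>(B :: (real^'n) set) (\<delta> :: real) (P0 :: (real^'n) measure) (l :: real \<Rightarrow> real)
      (A :: real^'n \<Rightarrow> real^'n^'n) (M :: real) (\<rho>min :: real) (\<rho>max :: real) (R :: real).
      \<delta> > 0 \<and> prob_space P0 \<and> sets P0 = sets borel \<and> (\<forall>x. sym_pos_def (A x)) \<and>
      lower_semicontinuous (\<lambda>(x, x'). cost A x x') \<and>
      \<rho>min > 0 \<and> \<rho>max > 0 \<and>
      (AE x in P0. \<forall>v. norm v = 1 \<longrightarrow> \<rho>min \<le> v \<bullet> (A x *v v) \<and> v \<bullet> (A x *v v) \<le> \<rho>max) \<and>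
      convex_on UNIV l \<and> kappa l < \<infinity> \<and> integrable P0 (\<lambda>x. norm x ^ 4) \<and>
      (\<forall>u. l differentiable (at u)) \<and> (\<forall>u. deriv l differentiable (at u)) \<and>
      M > 0 \<and> (\<forall>u. deriv (deriv l) u \<le> M) \<and>
      (\<forall>\<beta>\<in>B. \<not> (AE x in P0. deriv l (\<beta> \<bullet> x) = 0)) \<and>
      convex B \<and> compact B \<and> bdd_above (norm ` B) \<and> R = (SUP \<beta>\<in>B. norm \<beta>)
      \<longrightarrow>
      (let K1 = k1 \<delta> M R \<rho>max \<rho>min (slope_min P0 l B) (slope_max P0 l B);
           K2 = k2 \<delta> M R \<rho>max \<rho>min (slope_min P0 l B) (slope_max P0 l B)
       in K1 > 0 \<and> K2 > 0 \<and>
          (\<forall>\<beta>\<in>B. \<forall>lam. is_arg_min (f_dual P0 \<delta> l A \<beta>) (\<lambda>s. s \<ge> 0) lam \<longrightarrow>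
             (\<beta>, lam) \<in> V_region B K1 K2))"
proof -
  define D :: "real \<Rightarrow> real \<Rightarrow> real \<Rightarrow> real \<Rightarrow> real \<Rightarrow> real" where
    "D = (\<lambda>\<delta> M R \<rho>min S. M * sqrt \<delta> * \<bar>R\<bar> / (2 * \<rho>min) + 1 + S\<^sup>2 / (4 * \<rho>min))"
  \<comment> \<open>For empty \<open>B\<close> the numbers \<open>slope_min\<close>, \<open>slope_max\<close> and \<open>R\<close> are unspecified, yet the constants
    must be positive; hence the case distinction and the absolute value of \<open>R\<close>.\<close>
  show ?thesis
  proof (rule exI[of _ "\<lambda>\<delta> M R \<rho>max \<rho>min s S. if s > 0 then s\<^sup>2 / (4 * \<rho>max * D \<delta> M R \<rho>min S) else 1"],
      rule exI[of _ "\<lambda>\<delta> M R \<rho>max \<rho>min s S. D \<delta> M R \<rho>min S"],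
      intro allI impI, unfold Let_def, elim conjE, intro conjI ballI allI impI)
    fix B :: "(real^'n) set" and P0 :: "(real^'n) measure" and l :: "real \<Rightarrow> real"
      and A :: "real^'n \<Rightarrow> real^'n^'n" and \<delta> M \<rho>min \<rho>max R :: real
    \<comment> \<open>These signs alone make both constants positive, including for empty
      \<open>B\<close>.\<close>
    assume pos: "\<delta> > 0" "\<rho>min > 0" "\<rho>max > 0" "M > 0"
    have D_pos: "D \<delta> M R \<rho>min S > 0" for S
    proof -
      have "M * sqrt \<delta> * \<bar>R\<bar> / (2 * \<rho>min) \<ge> 0" "S\<^sup>2 / (4 * \<rho>min) \<ge> 0"
        using pos by simp_all
      then show ?thesis unfolding D_def by linarith
    qed
    then show "D \<delta> M R \<rho>min (slope_max P0 l B) > 0" .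
    show "(if slope_min P0 l B > 0
        then (slope_min P0 l B)\<^sup>2 / (4 * \<rho>max * D \<delta> M R \<rho>min (slope_max P0 l B)) else 1) > 0"
      using D_pos pos by simp
    fix \<beta> lam
    assume "prob_space P0" "sets P0 = sets borel" "convex_on UNIV l"
      "integrable P0 (\<lambda>x. norm x ^ 4)" "\<forall>u. l differentiable (at u)"
      "\<forall>u. deriv l differentiable (at u)" "\<forall>u. deriv (deriv l) u \<le> M"
    then interpret smooth_convex_model l M P0
      using pos by (auto simp: smooth_convex_model_def smooth_convex_loss_def
          smooth_convex_model_axioms_def)
    assume B: "compact B" "bdd_above (norm ` B)" "R = (SUP \<beta>\<in>B. norm \<beta>)" "\<beta> \<in> B"
      "\<forall>\<beta>\<in>B. \<not> (AE x in P0. deriv l (\<beta> \<bullet> x) = 0)"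
    have R: "norm \<beta> \<le> R" using B by (auto intro: cSUP_upper)
    have s: "slope_min P0 l B > 0" using B by (intro slope_min_pos) auto
    \<comment> \<open>A member \<open>\<beta>\<close> of \<open>B\<close> forces
      \<open>R \<ge> 0\<close>, which removes the absolute value.\<close>
    have D: "D \<delta> M R \<rho>min (slope_max P0 l B)
        = M * sqrt \<delta> * R / (2 * \<rho>min) + 1 + (slope_max P0 l B)\<^sup>2 / (4 * \<rho>min)"
      using order_trans[OF norm_ge_zero R] by (simp add: D_def)
    assume spd: "\<forall>x. sym_pos_def (A x)"
      and spectrum: "AE x in P0. \<forall>v. norm v = 1 \<longrightarrow>
        \<rho>min \<le> v \<bullet> (A x *v v) \<and> v \<bullet> (A x *v v) \<le> \<rho>max"
      and opt: "is_arg_min (f_dual P0 \<delta> l A \<beta>) (\<lambda>s. s \<ge> 0) lam"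
    note dual_optimizer_bounds[OF pos(1) spd[rule_format] pos(2,3) spectrum opt R
        less_imp_le[OF s] slope_norm_bounds[OF B(1,4)] D]
    then show "(\<beta>, lam) \<in> V_region B
        (if slope_min P0 l B > 0
         then (slope_min P0 l B)\<^sup>2 / (4 * \<rho>max * D \<delta> M R \<rho>min (slope_max P0 l B)) else 1)
        (D \<delta> M R \<rho>min (slope_max P0 l B))"
      using s opt B(4) by (simp add: V_region_def is_arg_min_def)
  qed
qed

end
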